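(* The continuous Gromov--Hausdorff distance satisfies the triangle inequality: for all non-empty metric spaces $X$, $Y$, $Z$, $$d^c_{GH}(X,Z)\le d^c_{GH}(X,Y)+d^c_{GH}(Y,Z).$$
   Context: All metric spaces are non-empty; $|xx'|$ denotes the distance between points $x,x'$ of a metric space. For maps $f\colon X\to Y$ and $g\colon Y\to X$ between metric spaces put $$\operatorname{dis} f=\sup_{x,x'\in X}\bigl||xx'|-|f(x)f(x')|\bigr|,\qquad \operatorname{codis}(f,g)=\sup_{x\in X,\,y\in Y}\bigl||x\,g(y)|-|f(x)\,y|\bigr|,$$ ($\operatorname{dis} g$ is defined analogously). The continuous Gromov--Hausdorff distance is $$d^c_{GH}(X,Y)=\frac12\inf_{f,g}\max\{\operatorname{dis} f,\operatorname{dis} g,\operatorname{codis}(f,g)\}\in[0,\infty],$$ the infimum being over all continuous maps $f\colon X\to Y$ and $g\colon Y\to X$. *)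

theory Defs
  imports "HOL-Analysis.Analysis"
begin

text \<open>
  Metric spaces are elements of the library type \<open>'a metric\<close>, so a space is a carrier set
  \<open>mspace X\<close> with a distance \<open>mdist X\<close>. The library admits empty carriers. A map
  \<open>X \<rightarrow> Y\<close> is a total function whose values outside \<open>mspace X\<close> are
  irrelevant: every supremum below ranges over carriers only. Suprema and infima are taken in
  \<open>ennreal\<close>, i.e. in $[0,\infty]$.
\<close>

definition dis :: "'a metric \<Rightarrow> 'b metric \<Rightarrow> ('a \<Rightarrow> 'b) \<Rightarrow> ennreal" where
  "dis X Y f =
     (SUP (x, x') \<in> mspace X \<times> mspace X.
        ennreal \<bar>mdist X x x' - mdist Y (f x) (f x')\<bar>)"

definition codis ::
  "'a metric \<Rightarrow> 'b metric \<Rightarrow> ('a \<Rightarrow> 'b) \<Rightarrow> ('b \<Rightarrow> 'a) \<Rightarrow> ennreal" where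
  "codis X Y f g =
     (SUP (x, y) \<in> mspace X \<times> mspace Y.
        ennreal \<bar>mdist X x (g y) - mdist Y (f x) y\<bar>)"

definition dGHc :: "'a metric \<Rightarrow> 'b metric \<Rightarrow> ennreal" where
  "dGHc X Y =
     (1 / 2) * Inf {max (dis X Y f) (max (dis Y X g) (codis X Y f g)) | f g.
        continuous_map (mtopology_of X) (mtopology_of Y) f \<and>
        continuous_map (mtopology_of Y) (mtopology_of X) g}"

end

theory Submission
  imports Defs
begin

text \<open>Admissible pairs compose: from continuous \<open>f\<close>, \<open>g\<close> between X
  and Y and \<open>f'\<close>, \<open>g'\<close> between Y and Z one gets the continuous pair
  \<open>f' \<circ> f\<close>, \<open>g \<circ> g'\<close> between X and Z. Distortion and
  codistortion are subadditive under this composition (\<open>dis_comp_le\<close>,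
  \<open>codis_comp_le\<close>), because a distance in X and one in Z can be compared through a
  distance in Y. So the maximum for the composite pair is at most the sum of the two maxima, and
  \<open>le_Inf_add_Inf_ennreal\<close> passes to the infima independently in both pairs.\<close>

lemma ennreal_abs_diff_triangle:
  fixes a b c :: real
  shows "ennreal \<bar>a - c\<bar> \<le> ennreal \<bar>a - b\<bar> + ennreal \<bar>b - c\<bar>"
proof -
  have "ennreal \<bar>a - c\<bar> \<le> ennreal (\<bar>a - b\<bar> + \<bar>b - c\<bar>)"
    by (rule ennreal_leI) linarith
  then show ?thesis
    by simp
qed

lemma le_dis:
  assumes "x \<in> mspace X" "x' \<in> mspace X"
  shows "ennreal \<bar>mdist X x x' - mdist Y (f x) (f x')\<bar> \<le> dis X Y f"
  unfolding dis_def by (rule SUP_upper2 [where i = "(x, x')"]) (use assms in auto)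

lemma le_codis:
  assumes "x \<in> mspace X" "y \<in> mspace Y"
  shows "ennreal \<bar>mdist X x (g y) - mdist Y (f x) y\<bar> \<le> codis X Y f g"
  unfolding codis_def by (rule SUP_upper2 [where i = "(x, y)"]) (use assms in auto)

text \<open>The intermediate distance is that of \<open>f x\<close> and \<open>f x'\<close>, which
  lie in the carrier of Y, so the second difference is bounded by \<open>dis Y Z f'\<close>.\<close>

lemma dis_comp_le:
  assumes "f \<in> mspace X \<rightarrow> mspace Y"
  shows "dis X Z (f' \<circ> f) \<le> dis X Y f + dis Y Z f'"
proof -
  have "ennreal \<bar>mdist X x x' - mdist Z ((f' \<circ> f) x) ((f' \<circ> f) x')\<bar> \<le> dis X Y f + dis Y Z f'"
    if "x \<in> mspace X" "x' \<in> mspace X" for x x'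
  proof -
    have "f x \<in> mspace Y" "f x' \<in> mspace Y"
      using assms that by auto
    then show ?thesis
      unfolding comp_apply
      by (intro order_trans
          [OF ennreal_abs_diff_triangle [where b = "mdist Y (f x) (f x')"] add_mono] le_dis that)
  qed
  then show ?thesis
    unfolding dis_def [of X Z] by (auto intro!: SUP_least)
qed

text \<open>The intermediate distance is that of \<open>f x\<close> and \<open>g' z\<close> in Y:
  the first difference is the codistortion term of \<open>f\<close>, \<open>g\<close> at
  \<open>(x, g' z)\<close>, the second that of \<open>f'\<close>, \<open>g'\<close> at
  \<open>(f x, z)\<close>.\<close>

lemma codis_comp_le:
  assumes "f \<in> mspace X \<rightarrow> mspace Y" and "g' \<in> mspace Z \<rightarrow> mspace Y"
  shows "codis X Z (f' \<circ> f) (g \<circ> g') \<le> codis X Y f g + codis Y Z f' g'"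
proof -
  have "ennreal \<bar>mdist X x ((g \<circ> g') z) - mdist Z ((f' \<circ> f) x) z\<bar> \<le> codis X Y f g + codis Y Z f' g'"
    if "x \<in> mspace X" "z \<in> mspace Z" for x z
  proof -
    have "f x \<in> mspace Y" "g' z \<in> mspace Y"
      using assms that by auto
    then show ?thesis
      unfolding comp_apply
      by (intro order_trans
          [OF ennreal_abs_diff_triangle [where b = "mdist Y (f x) (g' z)"] add_mono] le_codis that)
  qed
  then show ?thesis
    unfolding codis_def [of X Z] by (auto intro!: SUP_least)
qed

text \<open>Adding a constant is monotone and right-continuous on \<open>ennreal\<close>, hence
  commutes with infima of non-empty sets.\<close>

lemma Inf_add_const_ennreal:
  fixes A :: "ennreal set"
  assumes "A \<noteq> {}"
  shows "Inf A + c = (INF a\<in>A. a + c)"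
  using assms continuous_at_Inf_mono [of "\<lambda>x. x + c" A]
    continuous_add [of "at_right (Inf A)" "\<lambda>x. x" "\<lambda>x. c"]
  by (auto simp: mono_def)

text \<open>The infimum is taken over \<open>B\<close> with \<open>a\<close> fixed, then over
  \<open>A\<close>. This replaces an epsilon argument, which would need infinite values treated
  separately.\<close>

lemma le_Inf_add_Inf_ennreal:
  fixes A B :: "ennreal set"
  assumes "\<And>a b. a \<in> A \<Longrightarrow> b \<in> B \<Longrightarrow> c \<le> a + b"
  shows "c \<le> Inf A + Inf B"
proof (cases "A = {} \<or> B = {}")
  \<comment> \<open>The infimum of the empty set is \<infinity>, so the right-hand side is
    \<infinity>.\<close>
  case True
  then show ?thesis by auto
next
  case False
  have "c \<le> a + Inf B" if "a \<in> A" for a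
  proof -
    have "Inf B + a = (INF b\<in>B. b + a)"
      using False by (intro Inf_add_const_ennreal) auto
    moreover have "c \<le> (INF b\<in>B. b + a)"
      using assms that by (intro INF_greatest) (simp add: add.commute [of _ a])
    ultimately show ?thesis
      by (simp add: add.commute)
  qed
  then have "c \<le> (INF a\<in>A. a + Inf B)"
    by (rule INF_greatest)
  also have "\<dots> = Inf A + Inf B"
    using False by (intro Inf_add_const_ennreal [symmetric]) auto
  finally show ?thesis .
qed

theorem proposition3p1:
  fixes X :: "'a metric" and Y :: "'b metric" and Z :: "'c metric"
  assumes "mspace X \<noteq> {}" and "mspace Y \<noteq> {}" and "mspace Z \<noteq> {}"
  shows "dGHc X Z \<le> dGHc X Y + dGHc Y Z"
proof -
  let ?m = "\<lambda>f g. max (dis X Y f) (max (dis Y X g) (codis X Y f g))"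
  let ?m' = "\<lambda>f g. max (dis Y Z f) (max (dis Z Y g) (codis Y Z f g))"
  let ?m'' = "\<lambda>f g. max (dis X Z f) (max (dis Z X g) (codis X Z f g))"
  let ?D = "Inf {?m'' f g | f g.
      continuous_map (mtopology_of X) (mtopology_of Z) f \<and>
      continuous_map (mtopology_of Z) (mtopology_of X) g}"
  have le: "?D \<le> ?m f g + ?m' f' g'"
    if f: "continuous_map (mtopology_of X) (mtopology_of Y) f"
      and g: "continuous_map (mtopology_of Y) (mtopology_of X) g"
      and f': "continuous_map (mtopology_of Y) (mtopology_of Z) f'"
      and g': "continuous_map (mtopology_of Z) (mtopology_of Y) g'" for f g f' g'
  proof -
    have maps: "f \<in> mspace X \<rightarrow> mspace Y" "g' \<in> mspace Z \<rightarrow> mspace Y"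
      using continuous_map_funspace [OF f] continuous_map_funspace [OF g'] by auto
    have "dis X Z (f' \<circ> f) \<le> ?m f g + ?m' f' g'"
      by (rule order_trans [OF dis_comp_le [OF maps(1)] add_mono]) auto
    \<comment> \<open>The backward composite passes through \<open>g'\<close> first, so its two
      summands arise in the opposite order.\<close>
    moreover have "dis Z X (g \<circ> g') \<le> ?m f g + ?m' f' g'"
      by (subst add.commute [of "?m f g"], rule order_trans [OF dis_comp_le [OF maps(2)] add_mono])
        (simp_all add: le_max_iff_disj)
    moreover have "codis X Z (f' \<circ> f) (g \<circ> g') \<le> ?m f g + ?m' f' g'"
      by (rule order_trans [OF codis_comp_le [OF maps] add_mono]) (simp_all add: le_max_iff_disj)
    ultimately have "?m'' (f' \<circ> f) (g \<circ> g') \<le> ?m f g + ?m' f' g'"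
      by simp
    \<comment> \<open>The composites are continuous, so they compete in the infimum for X and
      Z.\<close>
    moreover have "?D \<le> ?m'' (f' \<circ> f) (g \<circ> g')"
      using continuous_map_compose [OF f f'] continuous_map_compose [OF g' g]
      by (intro Inf_lower) blast
    ultimately show ?thesis
      by (rule order_trans [rotated])
  qed
  \<comment> \<open>With the common factor 1/2 pulled out, only the inequality between the infima
    remains.\<close>
  show ?thesis
    unfolding dGHc_def distrib_left [symmetric]
    by (intro mult_left_mono le_Inf_add_Inf_ennreal) (use le in auto)
qed

end
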